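(* Fix $j\in\mathcal{J}$ and let $U_j^{p+1}(\cdot)$ be the $(p+1)$-upper envelope of the set of lines $\mathcal{L}_j$, with $p=\lfloor \epsilon|\mathcal{S}|\rfloor$. Then the inequality $$U_j^{p+1}(\hat{a}_j^{\top}x)+x^{\top}a_j^{0}\le 0,\qquad x\in X,$$ is valid for problem (P), i.e. it is satisfied by every feasible solution $(x,y)$ of (P).
   Context: Data: finite index sets $\mathcal{I}$, $\mathcal{J}$ and $\mathcal{S}=\{1,\dots,|\mathcal{S}|\}$ (scenarios); a set $X\subseteq\mathbb{R}^{|\mathcal{I}|}$ (deterministic constraints); a convex function $f:\mathbb{R}^{|\mathcal{I}|}\to\mathbb{R}$; a risk parameter $\epsilon\in(0,1)$ and $p:=\lfloor\epsilon|\mathcal{S}|\rfloor$; vectors $a_j^0,\hat{a}_j\in\mathbb{R}^{|\mathcal{I}|}$ for $j\in\mathcal{J}$; real numbers $\Omega_{js},b_{js}$ for $j\in\mathcal{J},s\in\mathcal{S}$ (no sign assumptions); and constants $M_{js}$ chosen large enough that the corresponding constraint below is redundant when $y_s=1$. Problem (P): $$\min_{x,y}\ f(x)\quad\text{s.t.}\quad x\in X;\quad \Omega_{js}\hat{a}_j^{\top}x-b_{js}+x^{\top}a_j^0\le M_{js}y_s\ \ \forall j\in\mathcal{J},s\in\mathcal{S};\quad \sum_{s\in\mathcal{S}}y_s\le p;\quad y_s\in\{0,1\}\ \ \forall s\in\mathcal{S}.$$ For $j\in\mathcal{J}$ put $z_j^d=\inf_{x\in X}\hat{a}_j^{\top}x$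 and $z_j^u=\sup_{x\in X}\hat{a}_j^{\top}x$. Let $L_{js}$ be the function (line) $f_{js}(z)=\Omega_{js}z-b_{js}$ for $z\in[z_j^d,z_j^u]$, and $\mathcal{L}_j=\{L_{js}:s\in\mathcal{S}\}$. The line $L_{js}$ lies above, contains, or lies below a point $(\tilde z,\tilde t)\in\mathbb{R}^2$ according to whether $\tilde t<\Omega_{js}\tilde z-b_{js}$, $\tilde t=\Omega_{js}\tilde z-b_{js}$, or $\tilde t>\Omega_{js}\tilde z-b_{js}$. A point belongs to $\mathcal{L}_j$ if some line in $\mathcal{L}_j$ contains it. The upper score of a point is the number of lines of $\mathcal{L}_j$ lying above it. The $k$-upper envelope of $\mathcal{L}_j$ is the closure of the set of points that belong to $\mathcal{L}_j$ and have upper score equal to $k-1$; it is regarded as (the graph of) a piecewise linear function of $z$ on $[z_j^d,z_j^u]$, and $U_j^{k}(z)$ denotes its value at $z$.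
   Formalization: It is assumed in addition that the (p+1)-upper envelope of the set of lines is nonempty, i.e. that the scenarios give at least p+1 distinct lines (coincident lines count once); otherwise the envelope has no value and the inequality is undefined. *)

theory Defs
  imports "HOL-Analysis.Analysis"
begin

record 'v min_problem =
  objective :: "'v \<Rightarrow> real"
  feasible_set :: "'v set"

definition valid_inequality :: "'v min_problem \<Rightarrow> ('v \<Rightarrow> real) \<Rightarrow> bool" where
  "valid_inequality P g \<longleftrightarrow> (\<forall>v\<in>feasible_set P. g v \<le> 0)"

definition problem_P ::
  "(real^'i \<Rightarrow> real) \<Rightarrow> (real^'i) set \<Rightarrow> ('j \<Rightarrow> 's \<Rightarrow> real) \<Rightarrow> ('j \<Rightarrow> real^'i) \<Rightarrow>
   ('j \<Rightarrow> 's \<Rightarrow> real) \<Rightarrow> ('j \<Rightarrow> real^'i) \<Rightarrow> ('j \<Rightarrow> 's \<Rightarrow> real) \<Rightarrow> nat \<Rightarrow>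
   ((real^'i::finite) \<times> (real^'s::finite)) min_problem" where
  "problem_P f X \<Omega> a_hat b a0 M p = \<lparr>
     objective = (\<lambda>(x, y). f x),
     feasible_set = {(x, y).
        x \<in> X \<and>
        (\<forall>j s. \<Omega> j s * (a_hat j \<bullet> x) - b j s + x \<bullet> a0 j \<le> M j s * y $ s) \<and>
        (\<Sum>s\<in>UNIV. y $ s) \<le> real p \<and>
        (\<forall>s. y $ s \<in> {0, 1})} \<rparr>"

text \<open>The bounds are extended reals, since the set of deterministic constraints need not be
  bounded; for an infinite bound the interval of admissible \<open>z\<close> is a half-line or the whole line.\<close>

definition z_lower :: "(real^'i::finite) set \<Rightarrow> real^'i \<Rightarrow> ereal" where
  "z_lower X a = (INF x\<in>X. ereal (a \<bullet> x))"

definition z_upper :: "(real^'i::finite) set \<Rightarrow> real^'i \<Rightarrow> ereal" where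
  "z_upper X a = (SUP x\<in>X. ereal (a \<bullet> x))"

text \<open>A line is a partial function whose domain is the interval of admissible \<open>z\<close>. Hence two
  scenarios give the same element of \<open>scenario_lines\<close> exactly if their lines agree on that
  interval, and such coincident lines are counted once in \<open>upper_score\<close>.\<close>

definition scenario_line ::
  "(real^'i::finite) set \<Rightarrow> real^'i \<Rightarrow> real \<Rightarrow> real \<Rightarrow> (real \<rightharpoonup> real)" where
  "scenario_line X a \<omega> \<beta> =
     (\<lambda>z. if z_lower X a \<le> ereal z \<and> ereal z \<le> z_upper X a then Some (\<omega> * z - \<beta>) else None)"

definition scenario_lines ::
  "(real^'i::finite) set \<Rightarrow> ('j \<Rightarrow> 's \<Rightarrow> real) \<Rightarrow> ('j \<Rightarrow> real^'i) \<Rightarrow> ('j \<Rightarrow> 's \<Rightarrow> real) \<Rightarrow>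
   'j \<Rightarrow> (real \<rightharpoonup> real) set" where
  "scenario_lines X \<Omega> a_hat b j = range (\<lambda>s. scenario_line X (a_hat j) (\<Omega> j s) (b j s))"

definition line_contains :: "(real \<rightharpoonup> real) \<Rightarrow> real \<times> real \<Rightarrow> bool" where
  "line_contains L q \<longleftrightarrow> L (fst q) = Some (snd q)"

definition line_above :: "(real \<rightharpoonup> real) \<Rightarrow> real \<times> real \<Rightarrow> bool" where
  "line_above L q \<longleftrightarrow> (\<exists>u. L (fst q) = Some u \<and> snd q < u)"

definition belongs_to :: "real \<times> real \<Rightarrow> (real \<rightharpoonup> real) set \<Rightarrow> bool" where
  "belongs_to q \<L> \<longleftrightarrow> (\<exists>L\<in>\<L>. line_contains L q)"

definition upper_score :: "(real \<rightharpoonup> real) set \<Rightarrow> real \<times> real \<Rightarrow> nat" where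
  "upper_score \<L> q = card {L \<in> \<L>. line_above L q}"

text \<open>Only \<open>k \<ge> 1\<close> is meaningful. The envelope is empty if \<open>\<L>\<close> has fewer than \<open>k\<close> lines.\<close>

definition upper_envelope :: "(real \<rightharpoonup> real) set \<Rightarrow> nat \<Rightarrow> (real \<times> real) set" where
  "upper_envelope \<L> k = closure {q. belongs_to q \<L> \<and> upper_score \<L> q + 1 = k}"

text \<open>The value at \<open>z\<close> of the function whose graph is the envelope; unspecified if the envelope is
  empty or \<open>z\<close> lies outside the common domain of the lines.\<close>

definition upper_envelope_fun :: "(real \<rightharpoonup> real) set \<Rightarrow> nat \<Rightarrow> real \<Rightarrow> real" where
  "upper_envelope_fun \<L> k z = (THE t. (z, t) \<in> upper_envelope \<L> k)"

end

(*
  Away from finitely many z (or at the only z, if the interval is a point) the lines take distinct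
  values, so exactly one line has p lines strictly above it there. By density and finiteness some
  line has this property at points accumulating at any given z, so the envelope meets the vertical
  line through z. Passing to the limit, an envelope point has at most p lines strictly above it and
  at least p + 1 lines weakly above it, which makes its height unique. A feasible solution violates
  the constraint in at most p scenarios, so not all of these p + 1 lines exceed - x \<bullet> a0,
  and U(z) \<le> - x \<bullet> a0.
*)

theory Submission imports Defs begin

text \<open>Elements are added in decreasing order: a new minimum leaves the counts of the old
  elements unchanged, and all old elements lie above it. Used to pick a line with a prescribed score
  among distinct values.\<close>

lemma ex_card_greater_eq:
  fixes A :: "'a::linorder set"
  assumes "finite A" and "m < card A"
  shows "\<exists>a\<in>A. card {b\<in>A. a < b} = m"
  using assms
proof (induction A rule: finite_linorder_min_induct)
  case empty
  then show ?case by simp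
next
  case (insert b A)
  have b: "b \<notin> A" using insert.hyps by auto
  show ?case
  proof (cases "m < card A")
    case True
    then obtain a where a: "a \<in> A" "card {b\<in>A. a < b} = m"
      using insert.IH by blast
    moreover have "{c \<in> insert b A. a < c} = {c\<in>A. a < c}"
      using a insert.hyps(2) by (auto dest: less_asym)
    ultimately show ?thesis by (metis insertI2)
  next
    case False
    then have "m = card A" using insert b by simp
    moreover have "{c \<in> insert b A. b < c} = A" using insert.hyps(2) by auto
    ultimately show ?thesis by auto
  qed
qed

text \<open>An envelope point \<open>q\<close> is a limit of points \<open>r n\<close> that lie on a
  line and have score exactly \<open>k - 1\<close>. Strict inequalities at \<open>q\<close> persist
  near \<open>q\<close>, and as there are finitely many lines, one \<open>n\<close> serves them all.
  Lines through \<open>q\<close> may pass above or below \<open>r n\<close>, so the exact score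
  survives only as two inequalities.\<close>

lemma upper_envelope_score_bounds:
  assumes fin: "finite \<L>"
    and dom: "\<And>L. L \<in> \<L> \<Longrightarrow> dom L = I"
    and cont: "\<And>L. L \<in> \<L> \<Longrightarrow> continuous_on I (\<lambda>z. the (L z))"
    and q: "q \<in> upper_envelope \<L> k" and qI: "fst q \<in> I"
  shows "upper_score \<L> q < k"
    and "k \<le> card {L\<in>\<L>. line_above L q \<or> line_contains L q}"
proof -
  obtain r where r: "\<And>n. belongs_to (r n) \<L>" "\<And>n. upper_score \<L> (r n) + 1 = k"
    and lim: "r \<longlonglongrightarrow> q"
    using q unfolding upper_envelope_def closure_sequential by auto
  have rI: "fst (r n) \<in> I" for n
    using r(1)[of n] dom unfolding belongs_to_def line_contains_def by blast
  have above: "line_above L v \<longleftrightarrow> snd v < the (L (fst v))"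
    and below: "line_above L v \<or> line_contains L v \<longleftrightarrow> snd v \<le> the (L (fst v))"
    if "L \<in> \<L>" "fst v \<in> I" for L v
    using that dom[of L] unfolding line_above_def line_contains_def by (auto simp: dom_def)
  have val: "(\<lambda>n. the (L (fst (r n)))) \<longlonglongrightarrow> the (L (fst q))" if "L \<in> \<L>" for L
    by (rule continuous_on_tendsto_compose[OF cont[OF that] tendsto_fst[OF lim] qI])
       (simp add: rI)
  have snd: "(\<lambda>n. snd (r n)) \<longlonglongrightarrow> snd q" by (rule tendsto_snd[OF lim])
  have "\<forall>\<^sub>F n in sequentially. \<forall>L\<in>\<L>. (line_above L q \<longrightarrow> line_above L (r n))
      \<and> (line_above L (r n) \<or> line_contains L (r n) \<longrightarrow> line_above L q \<or> line_contains L q)"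
  proof (intro eventually_ball_finite[OF fin] ballI)
    fix L assume L: "L \<in> \<L>"
    consider "snd q < the (L (fst q))" | "snd q = the (L (fst q))" | "the (L (fst q)) < snd q"
      by linarith
    then show "\<forall>\<^sub>F n in sequentially. (line_above L q \<longrightarrow> line_above L (r n))
      \<and> (line_above L (r n) \<or> line_contains L (r n) \<longrightarrow> line_above L q \<or> line_contains L q)"
    proof cases
      case 1
      then have "\<forall>\<^sub>F n in sequentially. 0 < the (L (fst (r n))) - snd (r n)"
        by (intro order_tendstoD(1)[OF tendsto_diff[OF val[OF L] snd]]) simp
      then show ?thesis
        by (rule eventually_mono) (use 1 above[OF L rI] above[OF L qI] in auto)
    next
      \<comment> \<open>A line through \<open>q\<close> needs no limit: it falsifies the premise of
        the first implication and satisfies the conclusion of the second.\<close>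
      case 2
      then have "line_above L q \<or> line_contains L q" "\<not> line_above L q"
        using below[OF L qI] above[OF L qI] by simp_all
      then show ?thesis by simp
    next
      case 3
      then have "\<forall>\<^sub>F n in sequentially. the (L (fst (r n))) - snd (r n) < 0"
        by (intro order_tendstoD(2)[OF tendsto_diff[OF val[OF L] snd]]) simp
      then show ?thesis
        by (rule eventually_mono) (use 3 below[OF L rI] above[OF L qI] in auto)
    qed
  qed
  then obtain n where n: "\<And>L. L \<in> \<L> \<Longrightarrow> line_above L q \<Longrightarrow> line_above L (r n)"
    "\<And>L. L \<in> \<L> \<Longrightarrow> line_above L (r n) \<or> line_contains L (r n) \<Longrightarrow>
        line_above L q \<or> line_contains L q"
    using eventually_happens'[OF sequentially_bot] by blast
  have "upper_score \<L> q \<le> upper_score \<L> (r n)"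
    unfolding upper_score_def using fin n(1) by (intro card_mono) auto
  then show "upper_score \<L> q < k" using r(2)[of n] by simp
  obtain L where L: "L \<in> \<L>" "line_contains L (r n)"
    using r(1)[of n] unfolding belongs_to_def by blast
  have "\<not> line_above L (r n)"
    using L(2) unfolding line_above_def line_contains_def by auto
  \<comment> \<open>The line through \<open>r n\<close> is not among the \<open>k - 1\<close> lines
    strictly above it, so it supplies the missing unit.\<close>
  then have "k = card (insert L {L\<in>\<L>. line_above L (r n)})"
    using r(2)[of n] fin unfolding upper_score_def by simp
  also have "\<dots> \<le> card {L\<in>\<L>. line_above L q \<or> line_contains L q}"
    using fin n(2) L by (intro card_mono) auto
  finally show "k \<le> card {L\<in>\<L>. line_above L q \<or> line_contains L q}" .
qed

text \<open>Where the lines take distinct values, some line has score \<open>k - 1\<close>. Such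
  points are dense, and one of the finitely many lines must have this score at points converging to
  \<open>z\<close>; continuity carries that line's point into the closure.\<close>

lemma ex_upper_envelope_point:
  assumes fin: "finite \<L>"
    and dom: "\<And>L. L \<in> \<L> \<Longrightarrow> dom L = I"
    and cont: "\<And>L. L \<in> \<L> \<Longrightarrow> continuous_on I (\<lambda>z. the (L z))"
    and dense: "I \<subseteq> closure {z\<in>I. inj_on (\<lambda>L. L z) \<L>}"
    and ne: "upper_envelope \<L> k \<noteq> {}"
    and z: "z \<in> I"
  shows "\<exists>t. (z, t) \<in> upper_envelope \<L> k"
proof -
  define E where "E = {q. belongs_to q \<L> \<and> upper_score \<L> q + 1 = k}"
  define S where "S L = {z\<in>I. (z, the (L z)) \<in> E}" for L
  \<comment> \<open>Nonemptiness yields \<open>1 \<le> k \<le> card \<L>\<close>: a line containing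
    a point is not above it, so the score of that point is less than
    \<open>card \<L>\<close>.\<close>
  have "E \<noteq> {}" using ne unfolding upper_envelope_def E_def by auto
  then obtain q L where q: "upper_score \<L> q + 1 = k" and L: "L \<in> \<L>" "line_contains L q"
    unfolding E_def belongs_to_def by blast
  have "\<not> line_above L q"
    using L(2) unfolding line_above_def line_contains_def by auto
  then have "{L\<in>\<L>. line_above L q} \<subset> \<L>" using L(1) by blast
  then have "upper_score \<L> q < card \<L>"
    unfolding upper_score_def by (rule psubset_card_mono[OF fin])
  then have k: "k - 1 < card \<L>" "k \<ge> 1" using q by simp_all
  have "{z\<in>I. inj_on (\<lambda>L. L z) \<L>} \<subseteq> (\<Union>L\<in>\<L>. S L)"
  proof clarify
    fix z assume zI: "z \<in> I" and inj: "inj_on (\<lambda>L. L z) \<L>"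
    have Some: "L z = Some (the (L z))" if "L \<in> \<L>" for L
      using dom[OF that] zI by auto
    have inj': "inj_on (\<lambda>L. the (L z)) \<L>"
      using inj Some unfolding inj_on_def by metis
    \<comment> \<open>By injectivity at \<open>z\<close>, counting larger values is the same as
      counting lines above.\<close>
    then have "k - 1 < card ((\<lambda>L. the (L z)) ` \<L>)" using k by (simp add: card_image)
    then obtain L where L: "L \<in> \<L>"
      and card: "card {b \<in> (\<lambda>L. the (L z)) ` \<L>. the (L z) < b} = k - 1"
      using ex_card_greater_eq[of "(\<lambda>L. the (L z)) ` \<L>" "k - 1"] fin by blast
    have "{b \<in> (\<lambda>L. the (L z)) ` \<L>. the (L z) < b}
        = (\<lambda>L. the (L z)) ` {L'\<in>\<L>. line_above L' (z, the (L z))}"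
    proof -
      have "line_above L' (z, t) \<longleftrightarrow> t < the (L' z)" if "L' \<in> \<L>" for L' t
        using Some[OF that] unfolding line_above_def by (metis fst_conv option.sel snd_conv)
      then show ?thesis by blast
    qed
    then have "upper_score \<L> (z, the (L z)) = k - 1"
      using card card_image[OF inj_on_subset[OF inj'], of "{L'\<in>\<L>. line_above L' (z, the (L z))}"]
      unfolding upper_score_def by simp
    then have "z \<in> S L"
      using k L Some[OF L] zI unfolding S_def E_def belongs_to_def line_contains_def by auto
    then show "z \<in> (\<Union>L\<in>\<L>. S L)" using L by blast
  qed
  \<comment> \<open>A finite union of closed sets is closed, so a limit point can be charged to a
    single line.\<close>
  then have "closure {z\<in>I. inj_on (\<lambda>L. L z) \<L>} \<subseteq> (\<Union>L\<in>\<L>. closure (S L))"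
    by (intro closure_minimal closed_UN fin ballI closed_closure)
       (use closure_subset in blast)
  then obtain L where L: "L \<in> \<L>" "z \<in> closure (S L)" using dense z by blast
  then obtain w where w: "\<And>n. w n \<in> S L" "w \<longlonglongrightarrow> z"
    unfolding closure_sequential by blast
  have "(\<lambda>n. the (L (w n))) \<longlonglongrightarrow> the (L z)"
    by (rule continuous_on_tendsto_compose[OF cont[OF L(1)] w(2) z])
       (use w(1) in \<open>simp add: S_def\<close>)
  then have "(\<lambda>n. (w n, the (L (w n)))) \<longlonglongrightarrow> (z, the (L z))"
    by (intro tendsto_Pair w)
  moreover have "\<forall>n. (w n, the (L (w n))) \<in> E" using w(1) unfolding S_def by auto
  ultimately have "(z, the (L z)) \<in> closure E" unfolding closure_sequential by (intro exI conjI)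
  then show ?thesis unfolding upper_envelope_def E_def by blast
qed

text \<open>Makes the definite description meaningful. For heights \<open>t < t'\<close> over the
  same \<open>z\<close>, the at least \<open>k\<close> lines weakly above \<open>t'\<close> would
  all be strictly above \<open>t\<close>, where fewer than \<open>k\<close> are.\<close>

lemma upper_envelope_fun_mem:
  assumes "finite \<L>"
    and "\<And>L. L \<in> \<L> \<Longrightarrow> dom L = I"
    and "\<And>L. L \<in> \<L> \<Longrightarrow> continuous_on I (\<lambda>z. the (L z))"
    and "I \<subseteq> closure {z\<in>I. inj_on (\<lambda>L. L z) \<L>}"
    and "upper_envelope \<L> k \<noteq> {}"
    and z: "z \<in> I"
  shows "(z, upper_envelope_fun \<L> k z) \<in> upper_envelope \<L> k"
proof -
  have "\<not> t < t'" if t: "(z, t) \<in> upper_envelope \<L> k" "(z, t') \<in> upper_envelope \<L> k" for t t'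
  proof
    assume "t < t'"
    then have "{L\<in>\<L>. line_above L (z, t') \<or> line_contains L (z, t')}
        \<subseteq> {L\<in>\<L>. line_above L (z, t)}"
      unfolding line_above_def line_contains_def by auto
    then have "card {L\<in>\<L>. line_above L (z, t') \<or> line_contains L (z, t')} \<le> upper_score \<L> (z, t)"
      unfolding upper_score_def using assms(1) by (intro card_mono) auto
    then show False
      using upper_envelope_score_bounds(1)[OF assms(1-3) t(1)]
        upper_envelope_score_bounds(2)[OF assms(1-3) t(2)] z by simp
  qed
  then have "\<exists>!t. (z, t) \<in> upper_envelope \<L> k"
    using ex_upper_envelope_point[OF assms] by (metis linorder_neqE)
  then show ?thesis unfolding upper_envelope_fun_def by (rule theI')
qed

text \<open>Distinct affine functions meet at most once, so finitely many points are to be avoided,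
  and a connected set with more than one point has no isolated points.\<close>

lemma dense_inj_on_lines:
  fixes a b :: "'s::finite \<Rightarrow> real" and I :: "real set"
  assumes conn: "connected I"
  shows "I \<subseteq> closure {z\<in>I. inj_on (\<lambda>L. L z)
            (range (\<lambda>s z. if z \<in> I then Some (a s * z - b s) else None))}"
proof -
  define l where "l = (\<lambda>s z. if z \<in> I then Some (a s * z - b s) else None)"
  have l: "l s z = l s' z \<longleftrightarrow> z \<in> I \<longrightarrow> a s * z - b s = a s' * z - b s'" for s s' z
    unfolding l_def by simp
  let ?D = "{z\<in>I. inj_on (\<lambda>L. L z) (range l)}"
  have "z \<in> closure ?D" if z: "z \<in> I" for z
  proof (cases "I = {z}")
    case True
    \<comment> \<open>On a one-point interval, lines agreeing there are the same partial function,
      hence a single element of the range.\<close>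
    have "l s = l s'" if "l s z = l s' z" for s s'
    proof
      fix w
      have "w = z \<or> w \<notin> I" using True by blast
      then show "l s w = l s' w" using that l by metis
    qed
    then have "inj_on (\<lambda>L. L z) (range l)" by (auto intro!: inj_onI)
    then have "z \<in> ?D" using z by simp
    then show ?thesis by (rule subsetD[OF closure_subset])
  next
    case False
    define C where "C = (\<Union>(s, s')\<in>{(s, s'). l s \<noteq> l s'}. {z\<in>I. l s z = l s' z})"
    have "finite {z\<in>I. l s z = l s' z}" if "l s \<noteq> l s'" for s s'
    proof (cases "a s = a s'")
      case True
      \<comment> \<open>Parallel but different lines never meet.\<close>
      have "b s \<noteq> b s'" using that True by (auto simp: l_def)
      then have "{z\<in>I. l s z = l s' z} = {}" using True by (simp add: l)
      then show ?thesis by (simp only: finite.emptyI)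
    next
      case False
      have "z = (b s - b s') / (a s - a s')" if "z \<in> I" "l s z = l s' z" for z
      proof -
        have "z * (a s - a s') = b s - b s'" using that by (simp add: l algebra_simps)
        then show ?thesis using False by (simp add: nonzero_eq_divide_eq)
      qed
      then have "{z\<in>I. l s z = l s' z} \<subseteq> {(b s - b s') / (a s - a s')}" by blast
      then show ?thesis by (rule finite_subset) simp
    qed
    then have C: "finite C" unfolding C_def by (intro finite_UN_I) auto
    have D: "I - C \<subseteq> ?D"
    proof
      fix w assume w: "w \<in> I - C"
      have "l s = l s'" if "l s w = l s' w" for s s'
        using that w unfolding C_def by auto
      then show "w \<in> ?D" using w by (auto intro!: inj_onI)
    qed
    have "z islimpt I" using connected_imp_perfect[OF conn z] False z by blast
    then have "z islimpt C \<union> (I - C)" by (rule islimpt_subset) blast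
    then have "z islimpt (I - C)" by (simp only: islimpt_Un_finite[OF C])
    then have "z islimpt ?D" by (rule islimpt_subset[OF _ D])
    then show ?thesis unfolding closure_def by blast
  qed
  then have "I \<subseteq> closure ?D" by (rule subsetI)
  then show ?thesis unfolding l_def .
qed

theorem proposition2p3:
  fixes f :: "real^'i::finite \<Rightarrow> real"
    and X :: "(real^'i) set"
    and \<epsilon> :: real
    and p :: nat
    and a0 a_hat :: "'j::finite \<Rightarrow> real^'i"
    and \<Omega> b M :: "'j \<Rightarrow> 's::finite \<Rightarrow> real"
    and j :: 'j
  assumes "convex_on UNIV f"
    and "0 < \<epsilon>" and "\<epsilon> < 1"
    and "p = nat \<lfloor>\<epsilon> * real CARD('s)\<rfloor>"
    and big_M: "\<And>j s x. x \<in> X \<Longrightarrow> \<Omega> j s * (a_hat j \<bullet> x) - b j s + x \<bullet> a0 j \<le> M j s"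
    and envelope_exists: "upper_envelope (scenario_lines X \<Omega> a_hat b j) (p + 1) \<noteq> {}"
  shows "valid_inequality (problem_P f X \<Omega> a_hat b a0 M p)
           (\<lambda>(x, y). upper_envelope_fun (scenario_lines X \<Omega> a_hat b j) (p + 1) (a_hat j \<bullet> x)
                      + x \<bullet> a0 j)"
proof -
  define \<L> where "\<L> = scenario_lines X \<Omega> a_hat b j"
  define I where "I = {z. z_lower X (a_hat j) \<le> ereal z \<and> ereal z \<le> z_upper X (a_hat j)}"
  have line: "scenario_line X (a_hat j) \<omega> \<beta> = (\<lambda>z. if z \<in> I then Some (\<omega> * z - \<beta>) else None)" for \<omega> \<beta>
    unfolding scenario_line_def I_def by simp
  have L_eq: "\<L> = range (\<lambda>s z. if z \<in> I then Some (\<Omega> j s * z - b j s) else None)"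
    unfolding \<L>_def scenario_lines_def line ..
  have fin: "finite \<L>" unfolding L_eq by simp
  have dom: "dom L = I" if "L \<in> \<L>" for L
    using that unfolding L_eq by (auto simp: dom_def split: if_splits)
  have cont: "continuous_on I (\<lambda>z. the (L z))" if "L \<in> \<L>" for L
  proof -
    obtain s where "L = (\<lambda>z. if z \<in> I then Some (\<Omega> j s * z - b j s) else None)"
      using \<open>L \<in> \<L>\<close> unfolding L_eq by auto
    moreover have "continuous_on I (\<lambda>z. \<Omega> j s * z - b j s)" by (intro continuous_intros)
    ultimately show ?thesis by (simp cong: continuous_on_cong_simp)
  qed
  \<comment> \<open>Only transitivity of the order is used, so infinite bounds need no separate
    treatment; connectedness feeds the density lemma.\<close>
  have "is_interval I"
    unfolding is_interval_1
  proof (intro ballI allI impI)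
    fix u v w assume "u \<in> I" "v \<in> I" "u \<le> w \<and> w \<le> v"
    then have "z_lower X (a_hat j) \<le> ereal u" "ereal u \<le> ereal w"
      "ereal w \<le> ereal v" "ereal v \<le> z_upper X (a_hat j)"
      unfolding I_def by simp_all
    then show "w \<in> I" unfolding I_def by (blast intro: order_trans)
  qed
  then have dense: "I \<subseteq> closure {z\<in>I. inj_on (\<lambda>L. L z) \<L>}"
    unfolding L_eq by (intro dense_inj_on_lines is_interval_connected)
  have "upper_envelope_fun \<L> (p + 1) (a_hat j \<bullet> x) + x \<bullet> a0 j \<le> 0"
    if x: "x \<in> X" and le: "\<And>s. \<Omega> j s * (a_hat j \<bullet> x) - b j s + x \<bullet> a0 j \<le> M j s * y $ s"
      and sum: "(\<Sum>s\<in>UNIV. y $ s) \<le> real p" and y: "\<And>s. y $ s \<in> {0, 1}" for x y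
  proof (rule ccontr)
    let ?z = "a_hat j \<bullet> x" and ?U = "upper_envelope_fun \<L> (p + 1) (a_hat j \<bullet> x)"
    assume pos: "\<not> ?thesis"
    have z: "?z \<in> I"
      unfolding I_def z_lower_def z_upper_def using x by (auto intro: INF_lower SUP_upper)
    have U: "(?z, ?U) \<in> upper_envelope \<L> (p + 1)"
      using upper_envelope_fun_mem[OF fin dom cont dense _ z] envelope_exists
      unfolding \<L>_def by blast
    \<comment> \<open>Different scenarios may give the same line, so the lines are covered by an
      image of scenarios; the cardinality bound points in the needed direction.\<close>
    have "{L\<in>\<L>. line_above L (?z, ?U) \<or> line_contains L (?z, ?U)}
        \<subseteq> (\<lambda>s z. if z \<in> I then Some (\<Omega> j s * z - b j s) else None) ` {s. y $ s = 1}"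
    proof
      fix L assume L: "L \<in> {L\<in>\<L>. line_above L (?z, ?U) \<or> line_contains L (?z, ?U)}"
      then obtain s where s: "L = (\<lambda>z. if z \<in> I then Some (\<Omega> j s * z - b j s) else None)"
        unfolding L_eq by auto
      have "?U \<le> \<Omega> j s * ?z - b j s"
        using L z unfolding s line_above_def line_contains_def by auto
      \<comment> \<open>With \<open>y $ s = 0\<close> the constraint would put the line's value at
        most at \<open>- (x \<bullet> a0 j)\<close>, which is below \<open>?U\<close> by
        \<open>pos\<close>.\<close>
      then have "y $ s \<noteq> 0" using le[of s] pos by auto
      then show "L \<in> (\<lambda>s z. if z \<in> I then Some (\<Omega> j s * z - b j s) else None) ` {s. y $ s = 1}"
        using y[of s] s by blast
    qed
    then have "p + 1 \<le> card {s. y $ s = 1}"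
      using upper_envelope_score_bounds(2)[OF fin dom cont U] z
        surj_card_le[of "{s. y $ s = 1}"] by fastforce
    \<comment> \<open>As \<open>y\<close> is binary, its sum counts the scenarios allowed to be
      violated: at least \<open>p + 1\<close>, against a budget of \<open>p\<close>.\<close>
    moreover have "(\<Sum>s\<in>UNIV. y $ s) = (\<Sum>s\<in>UNIV. if y $ s = 1 then 1 else 0)"
      using y by (intro sum.cong) auto
    then have "(\<Sum>s\<in>UNIV. y $ s) = real (card {s. y $ s = 1})"
      by (simp flip: sum.inter_filter)
    ultimately show False using sum by linarith
  qed
  then show ?thesis
    unfolding valid_inequality_def problem_P_def \<L>_def by auto
qed

end
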